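(* No finite algorithm (i.e., one making finitely many eval and mark queries) can decide the existence of a connected strongly-proportional allocation of a pie, even for hungry agents with equal entitlements.
   Context: A pie is $C=[0,1)$ with the endpoints $0$ and $1$ identified (a circle); points are taken modulo $1$. A piece is connected if it is an arc, i.e., an interval $[a,b]$ with $a\le b$ or a set of the form $[0,a]\cup[b,1)$ with $a\le b$. There are $n$ agents; agent $i$ has a valuation $V_i$ on the algebra generated by arcs that is non-negative, finitely additive, normalized ($V_i(C)=1$), and atomless/continuous (points have value $0$). Agent $i$ is hungry if every arc of positive length has positive value. Equal entitlements means each agent is entitled to $1/n$. An allocation is a partition of the pie into $n$ pieces, pairwise disjoint except at endpoints, one per agent; it is connected if every piece is an arc, and strongly-proportional if every agent values her piece at more than $1/n$. Algorithms access valuations via eval queries (returning $V_i$ of a given arc) and mark queries (given agent $i$, a starting point $x$ and value $r$, returning a point $z$ such that the arc from $x$ to $z$ has value $r$ to agent $i$). *)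

theory Defs
  imports "HOL-Analysis.Analysis"
begin

definition pie :: "real set" where
  "pie = {0..<1}"

text \<open>
  \<open>arc_from x z A\<close>: \<open>A\<close> is the arc running in positive direction from \<open>x\<close> to \<open>z\<close>.
  For \<open>x = z\<close> both disjuncts apply: \<open>A\<close> is the point \<open>{x}\<close> or the whole pie.
\<close>

definition arc_from :: "real \<Rightarrow> real \<Rightarrow> real set \<Rightarrow> bool" where
  "arc_from x z A \<longleftrightarrow> x \<in> pie \<and> z \<in> pie \<and>
     (x \<le> z \<and> A = {x..z} \<or> z \<le> x \<and> A = {0..z} \<union> {x..<1})"

definition arcs :: "real set set" where
  "arcs = {A. \<exists>x z. arc_from x z A}"

definition arc_algebra :: "real set set" where
  "arc_algebra = algebra pie hull arcs"

text \<open>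
  For a finitely additive \<open>V\<close>, null points alone do not make \<open>V\<close> of an arc continuous
  in the endpoints of the arc, so continuity is required as well; it is what makes every
  mark query answerable.
\<close>

definition valuation :: "(real set \<Rightarrow> real) \<Rightarrow> bool" where
  "valuation V \<longleftrightarrow>
     (\<forall>A\<in>arc_algebra. 0 \<le> V A) \<and>
     (\<forall>A\<in>arc_algebra. \<forall>B\<in>arc_algebra. A \<inter> B = {} \<longrightarrow> V (A \<union> B) = V A + V B) \<and>
     V pie = 1 \<and>
     (\<forall>x\<in>pie. V {x} = 0) \<and>
     continuous_on {0..1} (\<lambda>x. V {0..<x})"

definition hungry :: "(real set \<Rightarrow> real) \<Rightarrow> bool" where
  "hungry V \<longleftrightarrow> (\<forall>A\<in>arcs. measure lborel A > 0 \<longrightarrow> V A > 0)"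

text \<open>Agents are the numbers \<open>i < n\<close>; \<open>x i\<close> and \<open>z i\<close> are the endpoints of the piece \<open>P i\<close>.\<close>

definition connected_allocation :: "nat \<Rightarrow> (nat \<Rightarrow> real set) \<Rightarrow> bool" where
  "connected_allocation n P \<longleftrightarrow> (\<Union>i<n. P i) = pie \<and>
     (\<exists>x z. (\<forall>i<n. arc_from (x i) (z i) (P i)) \<and>
            (\<forall>i<n. \<forall>j<n. i \<noteq> j \<longrightarrow> P i \<inter> P j \<subseteq> {x i, z i} \<inter> {x j, z j}))"

definition strongly_proportional ::
  "nat \<Rightarrow> (nat \<Rightarrow> real set \<Rightarrow> real) \<Rightarrow> (nat \<Rightarrow> real set) \<Rightarrow> bool" where
  "strongly_proportional n V P \<longleftrightarrow> (\<forall>i<n. V i (P i) > 1 / real n)"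

datatype query =
    Eval nat "real set"
  | Mark nat real real

fun legal_query :: "nat \<Rightarrow> query \<Rightarrow> bool" where
  "legal_query n (Eval i A) \<longleftrightarrow> i < n \<and> A \<in> arcs"
| "legal_query n (Mark i x r) \<longleftrightarrow> i < n \<and> x \<in> pie \<and> 0 \<le> r \<and> r \<le> 1"

fun response :: "(nat \<Rightarrow> real set \<Rightarrow> real) \<Rightarrow> query \<Rightarrow> real \<Rightarrow> bool" where
  "response V (Eval i A) a \<longleftrightarrow> a = V i A"
| "response V (Mark i x r) z \<longleftrightarrow> (\<exists>A. arc_from x z A \<and> V i A = r)"

datatype action =
    Query query
  | Answer bool

text \<open>
  An algorithm is an arbitrary adaptive strategy: it maps the responses received so far
  (oldest first) to the next query or to the final answer.
\<close>

type_synonym algorithm = "real list \<Rightarrow> action"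

text \<open>
  \<open>halts_with n V alg rs b\<close>: having received the responses \<open>rs\<close>, the algorithm asks only
  legal queries and, whichever admissible responses it gets, gives the answer \<open>b\<close> after
  finitely many of them. The number of queries need not be bounded uniformly in \<open>V\<close>.
\<close>

inductive halts_with ::
  "nat \<Rightarrow> (nat \<Rightarrow> real set \<Rightarrow> real) \<Rightarrow> algorithm \<Rightarrow> real list \<Rightarrow> bool \<Rightarrow> bool"
  for n V alg where
  halt: "alg rs = Answer b \<Longrightarrow> halts_with n V alg rs b"
| ask: "alg rs = Query q \<Longrightarrow> legal_query n q \<Longrightarrow>
    (\<And>a. response V q a \<Longrightarrow> halts_with n V alg (rs @ [a]) b) \<Longrightarrow>
    halts_with n V alg rs b"

definition decides_for_hungry ::
  "nat \<Rightarrow> algorithm \<Rightarrow> ((nat \<Rightarrow> real set \<Rightarrow> real) \<Rightarrow> bool) \<Rightarrow> bool" where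
  "decides_for_hungry n alg Q \<longleftrightarrow>
     (\<forall>V. (\<forall>i<n. valuation (V i) \<and> hungry (V i)) \<longrightarrow> halts_with n V alg [] (Q V))"

end

theory Submission
  imports Defs
begin

text \<open>
  If all agents value arcs by their length, no strongly-proportional connected allocation
  exists. A halting run on this instance only probes arcs with endpoints in a finite set
  \<open>T\<close>. Cut the pie into \<open>n\<close> arcs of length \<open>1 / n\<close> whose endpoints avoid \<open>T\<close>, and for each
  agent shift a little value across the first endpoint of her arc, within a
  neighbourhood free of points of \<open>T\<close>. No probed arc changes its value, so the
  algorithm gives the same answer, but now every agent values her arc above \<open>1 / n\<close>.
\<close>

section \<open>Arcs and their lengths\<close>

lemma arc_from_borel:
  assumes "arc_from x z A"
  shows "A \<in> sets borel" "A \<subseteq> pie"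
  using assms by (auto simp: arc_from_def pie_def)

text \<open>The Borel subsets of the pie form an algebra that contains all arcs, so they contain the
  generated one. Lebesgue measure is thus additive wherever a valuation has to be.\<close>

lemma arc_algebra_borel:
  assumes "A \<in> arc_algebra"
  shows "A \<in> sets borel" "A \<subseteq> pie"
proof -
  have "algebra pie {A \<in> sets borel. A \<subseteq> pie}"
    by (auto simp: algebra_iff_Un pie_def)
  then have "arc_algebra \<subseteq> {A \<in> sets borel. A \<subseteq> pie}"
    unfolding arc_algebra_def
    by (intro hull_minimal) (auto simp: arcs_def dest: arc_from_borel)
  with assms show "A \<in> sets borel" "A \<subseteq> pie" by auto
qed

lemma pie_subset_fmeasurable:
  assumes "A \<in> sets borel" "A \<subseteq> pie"
  shows "A \<in> fmeasurable lborel"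
proof (rule fmeasurableI2)
  show "{0..1::real} \<in> fmeasurable lborel" by (simp add: fmeasurable_compact)
qed (use assms in \<open>auto simp: pie_def\<close>)

lemma length_wrapping_arc:
  fixes x z :: real
  assumes "0 \<le> z" "z < x" "x < 1"
  shows "measure lborel ({0..z} \<union> {x..<1}) = z + (1 - x)"
proof -
  have "measure lborel ({0..z} \<union> {x..<1}) = measure lborel {0..z} + measure lborel {x..<1}"
    using assms by (intro measure_Union) auto
  then show ?thesis using assms by simp
qed

text \<open>Deleting the endpoints of each piece costs no length and makes the pieces truly
  disjoint, so their lengths add up inside the unit interval.\<close>

lemma length_disjoint_up_to_endpoints:
  fixes n :: nat
  assumes arcs: "\<And>i. i < n \<Longrightarrow> arc_from (x i) (z i) (P i)"
    and meet: "\<And>i j. i < n \<Longrightarrow> j < n \<Longrightarrow> i \<noteq> j \<Longrightarrow> P i \<inter> P j \<subseteq> {x i, z i}"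
  shows "(\<Sum>i<n. measure lborel (P i)) \<le> 1"
proof -
  define Q where "Q i = P i - {x i, z i}" for i
  have fm: "P i \<in> fmeasurable lborel" "Q i \<in> fmeasurable lborel" if "i < n" for i
  proof -
    note P = arc_from_borel[OF arcs[OF that]]
    then show "P i \<in> fmeasurable lborel" by (rule pie_subset_fmeasurable)
    from P show "Q i \<in> fmeasurable lborel"
      by (intro pie_subset_fmeasurable) (auto simp: Q_def)
  qed
  have "measure lborel (Q i) = measure lborel (P i)" if "i < n" for i
  proof -
    have "finite {x i, z i}" by simp
    then have "{x i, z i} \<in> null_sets lborel" by (rule finite_imp_null_set_lborel)
    then show ?thesis
      unfolding Q_def using fm[OF that] by (intro measure_Diff_null_set) auto
  qed
  then have "(\<Sum>i<n. measure lborel (P i)) = (\<Sum>i<n. measure lborel (Q i))" by simp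
  also have "\<dots> = measure lborel (\<Union>i<n. Q i)"
  proof (rule measure_UNION'[symmetric])
    show "pairwise (\<lambda>i j. disjnt (Q i) (Q j)) {..<n}"
      using meet unfolding pairwise_def disjnt_def Q_def by blast
  qed (use fm in auto)
  also have "\<dots> \<le> measure lborel {0..1::real}"
  proof (rule measure_mono_fmeasurable)
    show "(\<Union>i<n. Q i) \<subseteq> {0..1}"
      using arc_from_borel(2)[OF arcs] by (fastforce simp: Q_def pie_def)
    show "(\<Union>i<n. Q i) \<in> sets lborel"
      using fm(2) by (intro sets.finite_UN fmeasurableD) auto
    show "{0..1::real} \<in> fmeasurable lborel" by (simp add: fmeasurable_compact)
  qed
  finally show ?thesis by simp
qed

text \<open>Summing over the agents would give a total length above 1.\<close>

lemma no_strongly_proportional_length: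
  assumes "n \<ge> 1" "connected_allocation n P"
  shows "\<not> strongly_proportional n (\<lambda>_. measure lborel) P"
proof
  assume "strongly_proportional n (\<lambda>_. measure lborel) P"
  then have "(\<Sum>i<n. 1 / real n) < (\<Sum>i<n. measure lborel (P i))"
    using assms(1) by (intro sum_strict_mono) (auto simp: strongly_proportional_def lessThan_empty_iff)
  moreover have "(\<Sum>i<n. measure lborel (P i)) \<le> 1"
  proof -
    obtain x z where "\<forall>i<n. arc_from (x i) (z i) (P i)"
      "\<forall>i<n. \<forall>j<n. i \<noteq> j \<longrightarrow> P i \<inter> P j \<subseteq> {x i, z i} \<inter> {x j, z j}"
      using assms(2) by (auto simp: connected_allocation_def)
    then show ?thesis by (intro length_disjoint_up_to_endpoints[of n x z]) auto
  qed
  ultimately show False using assms(1) by simp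
qed


section \<open>Shifting value across a point\<close>

text \<open>The density is \<open>1/2\<close> on \<open>[c - d, c]\<close>, \<open>3/2\<close> on \<open>[c, c + d]\<close> and \<open>1\<close> elsewhere.\<close>

definition tilted_length :: "real \<Rightarrow> real \<Rightarrow> real set \<Rightarrow> real" where
  "tilted_length c d A = measure lborel A - measure lborel (A \<inter> {c - d..c}) / 2
     + measure lborel (A \<inter> {c..c + d}) / 2"

text \<open>Length is the degenerate tilt, so it inherits hunger and the valuation axioms from the
  general case.\<close>

lemma tilted_length_zero: "tilted_length c 0 = measure lborel"
proof
  fix A :: "real set"
  have "A \<inter> {c} = {} \<or> A \<inter> {c} = {c}" by auto
  then have "measure lborel (A \<inter> {c}) = 0" by (elim disjE) simp_all
  then show "tilted_length c 0 A = measure lborel A" by (simp add: tilted_length_def)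
qed

text \<open>The density is nowhere below \<open>1/2\<close>. Both non-negativity and hunger follow
  from this bound.\<close>

lemma tilted_length_ge_half:
  assumes "A \<in> sets borel" "A \<subseteq> pie"
  shows "measure lborel A / 2 \<le> tilted_length c d A"
proof -
  have "measure lborel (A \<inter> {c - d..c}) \<le> measure lborel A"
    using assms by (intro measure_mono_fmeasurable pie_subset_fmeasurable) auto
  moreover have "0 \<le> measure lborel (A \<inter> {c..c + d})" by simp
  ultimately show ?thesis unfolding tilted_length_def by linarith
qed

lemma tilted_length_Un:
  assumes A: "A \<in> sets borel" "A \<subseteq> pie" and B: "B \<in> sets borel" "B \<subseteq> pie"
    and disj: "A \<inter> B = {}"
  shows "tilted_length c d (A \<union> B) = tilted_length c d A + tilted_length c d B"
proof -
  have "measure lborel ((A \<union> B) \<inter> I) = measure lborel (A \<inter> I) + measure lborel (B \<inter> I)"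
    if "I \<in> sets borel" for I
  proof -
    have "A \<inter> I \<in> fmeasurable lborel" "B \<inter> I \<in> fmeasurable lborel"
      using A B that by (auto intro!: pie_subset_fmeasurable)
    moreover have "(A \<inter> I) \<inter> (B \<inter> I) = {}" using disj by auto
    ultimately show ?thesis
      unfolding Int_Un_distrib2 by (subst measure_Un3) auto
  qed
  from this[of UNIV] this[of "{c - d..c}"] this[of "{c..c + d}"] show ?thesis
    by (simp add: tilted_length_def field_simps)
qed

text \<open>The closed form in \<open>min\<close> and \<open>max\<close> makes continuity in
  \<open>x\<close> evident.\<close>

lemma measure_initial_Int_Icc:
  fixes a b x :: real
  assumes "0 \<le> a"
  shows "measure lborel ({0..<x} \<inter> {a..b}) = max 0 (min x b - a)"
proof (cases "x \<le> b")
  case True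
  then have "{0..<x} \<inter> {a..b} = {a..<x}" using assms by auto
  with True show ?thesis by (cases "a \<le> x") simp_all
next
  case False
  then have "{0..<x} \<inter> {a..b} = {a..b}" using assms by auto
  with False show ?thesis by (cases "a \<le> b") simp_all
qed

lemma valuation_tilted_length:
  assumes "0 \<le> d" "d \<le> c" "c + d < 1"
  shows "valuation (tilted_length c d)"
  unfolding valuation_def
proof (intro conjI ballI impI)
  fix A assume "A \<in> arc_algebra"
  have "0 \<le> measure lborel A / 2" by simp
  also have "\<dots> \<le> tilted_length c d A"
    by (intro tilted_length_ge_half arc_algebra_borel \<open>A \<in> arc_algebra\<close>)
  finally show "0 \<le> tilted_length c d A" .
next
  fix A B assume "A \<in> arc_algebra" "B \<in> arc_algebra" "A \<inter> B = {}"
  then show "tilted_length c d (A \<union> B) = tilted_length c d A + tilted_length c d B"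
    by (intro tilted_length_Un arc_algebra_borel)
next
  \<comment> \<open>Both intervals lie inside the pie, so the loss \<open>d / 2\<close> left of
    \<open>c\<close> and the gain \<open>d / 2\<close> right of it cancel in the total.\<close>
  have "pie \<inter> {c - d..c} = {c - d..c}" "pie \<inter> {c..c + d} = {c..c + d}"
    using assms by (auto simp: pie_def)
  then show "tilted_length c d pie = 1"
    using assms(1) by (simp add: tilted_length_def pie_def)
next
  fix x :: real assume "x \<in> pie"
  have "measure lborel ({x} \<inter> I) = 0" for I by (cases "x \<in> I") simp_all
  then show "tilted_length c d {x} = 0" by (simp add: tilted_length_def)
next
  have "tilted_length c d {0..<x} =
      x - max 0 (min x c - (c - d)) / 2 + max 0 (min x (c + d) - c) / 2"
    if "x \<in> {0..1}" for x
    using that assms by (simp add: tilted_length_def measure_initial_Int_Icc)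
  then show "continuous_on {0..1} (\<lambda>x. tilted_length c d {0..<x})"
    by (subst continuous_on_cong[OF refl]) (auto intro!: continuous_intros)
qed

lemma hungry_tilted_length: "hungry (tilted_length c d)"
  unfolding hungry_def
proof (intro ballI impI)
  fix A assume "A \<in> arcs" "measure lborel A > 0"
  then show "tilted_length c d A > 0"
    using tilted_length_ge_half[of A c d] arc_from_borel[of _ _ A]
    by (fastforce simp: arcs_def)
qed

text \<open>An arc without endpoints in the tilted interval either misses it or contains all of it;
  in the second case loss and gain cancel.\<close>

lemma tilted_length_unchanged:
  assumes "0 \<le> d" "0 \<le> c - d" "c + d < 1" "arc_from x z A"
    and "x \<notin> {c - d..c + d}" "z \<notin> {c - d..c + d}"
  shows "tilted_length c d A = measure lborel A"
proof -
  have "A \<inter> {c - d..c + d} = {} \<or> {c - d..c + d} \<subseteq> A"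
    using assms unfolding arc_from_def pie_def by auto
  then consider "A \<inter> {c - d..c} = {}" "A \<inter> {c..c + d} = {}"
    | "A \<inter> {c - d..c} = {c - d..c}" "A \<inter> {c..c + d} = {c..c + d}"
    using assms(1) by (fastforce simp: set_eq_iff)
  then show ?thesis
    by cases (use assms(1) in \<open>simp_all add: tilted_length_def\<close>)
qed

text \<open>The arc takes the whole gain and, up to the null point \<open>c\<close>, none of the
  loss.\<close>

lemma tilted_length_arc_starting_at:
  assumes "0 \<le> d" "{c..c + d} \<subseteq> A" "A \<inter> {c - d..c} \<subseteq> {c}"
  shows "tilted_length c d A = measure lborel A + d / 2"
proof -
  have "A \<inter> {c - d..c} = {c}" "A \<inter> {c..c + d} = {c..c + d}" using assms by auto
  then show ?thesis using assms(1) by (simp add: tilted_length_def)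
qed


section \<open>Runs on the length instance\<close>

lemma length_answers_mark:
  assumes "x \<in> pie" "0 \<le> r" "r \<le> 1"
  obtains z A where "arc_from x z A" "measure lborel A = r"
proof (cases "x + r < 1")
  case True
  with assms that[of "x + r" "{x..x + r}"] show thesis
    by (auto simp: arc_from_def pie_def)
next
  case False
  have "measure lborel ({0..x + r - 1} \<union> {x..<1}) = r"
  \<comment> \<open>For \<open>r = 1\<close> the arc ends where it began: its two intervals share
    the point \<open>x\<close>, so \<open>length_wrapping_arc\<close> does not apply.\<close>
  proof (cases "r = 1")
    case True
    then have "{0..x + r - 1} \<union> {x..<1} = {0..<1}" using assms by (auto simp: pie_def)
    with True show ?thesis by simp
  next
    case neq: False
    with False assms show ?thesis by (subst length_wrapping_arc) (auto simp: pie_def)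
  qed
  with False assms that[of "x + r - 1" "{0..x + r - 1} \<union> {x..<1}"] show thesis
    by (auto simp: arc_from_def pie_def)
qed

text \<open>Expresses that \<open>V\<close> cannot be told from length by probing arcs with
  endpoints in \<open>T\<close>. Recording points instead of arcs lets a later tilt simply stay away
  from them.\<close>

definition measures_length_at :: "nat \<Rightarrow> real set \<Rightarrow> (nat \<Rightarrow> real set \<Rightarrow> real) \<Rightarrow> bool" where
  "measures_length_at n T V \<longleftrightarrow>
     (\<forall>i<n. \<forall>x\<in>T. \<forall>z\<in>T. \<forall>A. arc_from x z A \<longrightarrow> V i A = measure lborel A)"

lemma measures_length_at_mono:
  "measures_length_at n T V \<Longrightarrow> S \<subseteq> T \<Longrightarrow> measures_length_at n S V"
  unfolding measures_length_at_def by blast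

text \<open>\<open>T\<close> holds the two endpoints of the evaluated arc, or of one arc that
  answers the mark query. One response is enough, as halting quantifies over all admissible
  ones.\<close>

lemma length_response:
  assumes "legal_query n q"
  obtains a T where "response (\<lambda>_. measure lborel) q a" "finite T"
    "\<And>V. measures_length_at n T V \<Longrightarrow> response V q a"
proof (cases q)
  case (Eval i A)
  with assms obtain x z where "i < n" "arc_from x z A" by (auto simp: arcs_def)
  with Eval that[of "measure lborel A" "{x, z}"] show thesis
    by (simp add: measures_length_at_def)
next
  case (Mark i x r)
  with assms obtain z A where "arc_from x z A" "measure lborel A = r"
    by (auto elim: length_answers_mark)
  moreover from Mark assms have "i < n" by simp
  ultimately show thesis
    using Mark by (intro that[of z "{x, z}"]) (auto simp: measures_length_at_def)
qed

text \<open>Following one admissible response at each query reduces the halting derivation to a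
  single finite run; \<open>T\<close> collects the endpoints of the arcs probed on it.\<close>

lemma finite_set_fixes_answer:
  assumes "halts_with n (\<lambda>_. measure lborel) alg rs b"
  shows "\<exists>T. finite T \<and>
    (\<forall>V b'. measures_length_at n T V \<longrightarrow> halts_with n V alg rs b' \<longrightarrow> b' = b)"
  using assms
proof induction
  case (halt rs b)
  have "b' = b" if "halts_with n V alg rs b'" for V b'
    using that halt by cases auto
  then show ?case by blast
next
  case (ask rs q b)
  from \<open>legal_query n q\<close> obtain a S where a: "response (\<lambda>_. measure lborel) q a"
    and S: "finite S" "\<And>V. measures_length_at n S V \<Longrightarrow> response V q a"
    by (rule length_response) blast
  from ask.IH[OF a] obtain T where T: "finite T"
    "\<And>V b'. measures_length_at n T V \<Longrightarrow> halts_with n V alg (rs @ [a]) b' \<Longrightarrow> b' = b"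
    by blast
  have "b' = b" if V: "measures_length_at n (S \<union> T) V" and "halts_with n V alg rs b'" for V b'
  proof -
    have "response V q a" by (rule S(2)) (rule measures_length_at_mono[OF V], simp)
    \<comment> \<open>Since \<open>a\<close> is admissible for \<open>V\<close> too, halting on
      \<open>V\<close> must also cover the branch continued by \<open>a\<close>.\<close>
    with that(2) \<open>alg rs = Query q\<close> have "halts_with n V alg (rs @ [a]) b'" by cases auto
    then show ?thesis by (intro T(2)[OF measures_length_at_mono[OF V]]) auto
  qed
  with S(1) T(1) show ?case by (intro exI[of _ "S \<union> T"]) blast
qed


section \<open>The equal cut\<close>

context
  fixes n :: nat and c :: real
  assumes n: "2 \<le> n" and c: "0 < c" "c < 1 / n"
begin

private definition cut :: "nat \<Rightarrow> real" where
  "cut i = c + i / n"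

text \<open>The last piece wraps through 0, because \<open>cut n\<close> would be
  \<open>c + 1\<close>, which is \<open>cut 0\<close> on the circle.\<close>

private definition piece :: "nat \<Rightarrow> real set" where
  "piece i = (if Suc i < n then {cut i..cut (Suc i)} else {0..cut 0} \<union> {cut i..<1})"

private lemma cut_le_iff: "cut i \<le> cut j \<longleftrightarrow> i \<le> j"
  using n by (simp add: cut_def divide_le_cancel)

private lemma cut_less_iff: "cut i < cut j \<longleftrightarrow> i < j"
  using n by (simp add: cut_def divide_less_cancel)

private lemma cut_Suc: "cut (Suc i) = cut i + 1 / n"
  by (simp add: cut_def add_divide_distrib)

private lemma cut_last: "i < n \<Longrightarrow> \<not> Suc i < n \<Longrightarrow> cut i = c + 1 - 1 / n"
proof -
  assume "i < n" "\<not> Suc i < n"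
  then have "real i = real n - 1" by (simp flip: of_nat_Suc)
  with n show ?thesis by (simp add: cut_def diff_divide_distrib)
qed

private lemma cut_range:
  assumes "i < n" shows "0 < cut i" "cut i < 1"
proof -
  show "0 < cut i" using c by (simp add: cut_def add_pos_nonneg)
  have "cut i \<le> cut (n - 1)" using assms by (simp add: cut_le_iff)
  also have "\<dots> < 1" using cut_last[of "n - 1"] n c by simp
  finally show "cut i < 1" .
qed

private lemma length_piece:
  assumes "i < n" shows "measure lborel (piece i) = 1 / n"
proof (cases "Suc i < n")
  case True
  then show ?thesis by (simp add: piece_def cut_Suc)
next
  case False
  moreover from this have "cut 0 < cut i" using n by (simp add: cut_less_iff)
  moreover have "cut 0 = c" by (simp add: cut_def)
  ultimately show ?thesis
    using cut_range[OF assms] cut_last[OF assms False] c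
    by (simp add: piece_def length_wrapping_arc)
qed

private lemma pieces_cover: "(\<Union>i<n. piece i) = pie"
proof
  show "(\<Union>i<n. piece i) \<subseteq> pie"
  proof
    fix y assume "y \<in> (\<Union>i<n. piece i)"
    then obtain i where "i < n" "y \<in> piece i" by auto
    then show "y \<in> pie"
      using cut_range[of i] cut_range[of "Suc i"] cut_range[of 0]
      by (auto simp: piece_def pie_def split: if_splits)
  qed
  show "pie \<subseteq> (\<Union>i<n. piece i)"
  proof
    fix y assume y: "y \<in> pie"
    show "y \<in> (\<Union>i<n. piece i)"
    proof (cases "y < cut 0")
      case True
      then have "y \<in> piece (n - 1)" using y by (simp add: piece_def pie_def)
      then show ?thesis using n by auto
    next
      case False
      \<comment> \<open>The last cut not beyond \<open>y\<close>: by maximality \<open>y\<close>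
        lies before the next cut, if there is one.\<close>
      define i where "i = Max {i. i < n \<and> cut i \<le> y}"
      have fin: "finite {i. i < n \<and> cut i \<le> y}" by simp
      have "0 \<in> {i. i < n \<and> cut i \<le> y}" using False n by simp
      then have "i \<in> {i. i < n \<and> cut i \<le> y}" unfolding i_def using fin by (metis Max_in empty_iff)
      then have i: "i < n" "cut i \<le> y" by auto
      have "y < cut (Suc i)" if "Suc i < n"
      proof (rule ccontr)
        assume "\<not> y < cut (Suc i)"
        then have "Suc i \<le> i" using Max_ge[OF fin, of "Suc i"] that by (simp add: i_def)
        then show False by simp
      qed
      then have "y \<in> piece i" using i y by (auto simp: piece_def pie_def)
      with i show ?thesis by auto
    qed
  qed
qed

text \<open>As \<open>i < j\<close>, piece \<open>i\<close> does not wrap. The second alternative is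
  the contact of the first and last pieces; for \<open>n = 2\<close> both contacts occur between the
  same two pieces.\<close>

private lemma pieces_meet:
  assumes "i < j" "j < n" "y \<in> piece i" "y \<in> piece j"
  shows "y = cut j \<and> j = Suc i \<or> y = cut 0 \<and> i = 0 \<and> Suc j = n"
proof -
  have "Suc i < n" using assms by simp
  then have y: "cut i \<le> y" "y \<le> cut (Suc i)" using assms(3) by (auto simp: piece_def)
  have "cut (Suc i) \<le> cut j" using assms(1) by (simp add: cut_le_iff)
  show ?thesis
  proof (cases "cut j \<le> y")
    case True
    with y \<open>cut (Suc i) \<le> cut j\<close> have "y = cut j" "cut j \<le> cut (Suc i)" by auto
    with assms(1) show ?thesis by (simp add: cut_le_iff)
  next
    case False
    then have "Suc j = n" "y \<le> cut 0" using assms(2,4) by (auto simp: piece_def split: if_splits)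
    moreover from this y have "cut i \<le> cut 0" by simp
    then have "i = 0" by (simp add: cut_le_iff)
    ultimately show ?thesis using y by simp
  qed
qed

private lemma connected_allocation_piece: "connected_allocation n piece"
  unfolding connected_allocation_def
proof (intro conjI pieces_cover exI allI impI)
  define z where "z i = (if Suc i < n then cut (Suc i) else cut 0)" for i
  show "arc_from (cut i) (z i) (piece i)" if "i < n" for i
    using cut_range[of i] cut_range[of "Suc i"] cut_range[of 0] that
    by (auto simp: arc_from_def piece_def pie_def z_def cut_le_iff)
  have *: "piece i \<inter> piece j \<subseteq> {cut i, z i} \<inter> {cut j, z j}" if "i < j" "j < n" for i j
    using pieces_meet[OF that] that by (fastforce simp: z_def)
  show "piece i \<inter> piece j \<subseteq> {cut i, z i} \<inter> {cut j, z j}"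
    if "i < n" "j < n" "i \<noteq> j" for i j
    using *[of i j] *[of j i] that by (cases "i < j") auto
qed

text \<open>The tilt is centred at the start of the piece, so the gain falls inside it and the loss
  before it; \<open>d < 1 / n\<close> keeps the gain from passing the next cut.\<close>

private lemma tilted_piece_gt:
  assumes i: "i < n" and d: "0 < d" "d < 1 / n" "cut i + d < 1"
  shows "tilted_length (cut i) d (piece i) > 1 / n"
proof -
  have "{cut i..cut i + d} \<subseteq> piece i" using d by (auto simp: piece_def cut_Suc)
  moreover have "piece i \<inter> {cut i - d..cut i} \<subseteq> {cut i}"
  proof (cases "Suc i < n")
    \<comment> \<open>The wrapping piece also contains \<open>{0..cut 0}\<close>, and the loss
      interval must stay clear of it. As \<open>n\<close> is at least 2, there is a cut
      \<open>k\<close> before \<open>i\<close>, at distance \<open>1 / n > d\<close>.\<close>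
    case False
    then obtain k where k: "i = Suc k" using n by (cases i) auto
    have "cut 0 \<le> cut k" by (simp add: cut_le_iff)
    then have "cut 0 < cut i - d" using d(2) by (simp add: k cut_Suc)
    with False show ?thesis by (auto simp: piece_def)
  qed (auto simp: piece_def)
  ultimately have "tilted_length (cut i) d (piece i) = 1 / n + d / 2"
    using d(1) by (subst tilted_length_arc_starting_at) (auto simp: length_piece[OF i])
  with d(1) show ?thesis by simp
qed

lemma tilted_instance:
  assumes T: "finite T" "\<And>i. i < n \<Longrightarrow> c + i / n \<notin> T"
  obtains V P where "\<And>i. i < n \<Longrightarrow> valuation (V i) \<and> hungry (V i)"
    "measures_length_at n T V" "connected_allocation n P" "strongly_proportional n V P"
proof -
  have "\<exists>d>0. d < 1 / n \<and> 0 \<le> cut i - d \<and> cut i + d < 1 \<and>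
      (\<forall>t\<in>T. t \<notin> {cut i - d..cut i + d})" if i: "i < n" for i
  proof -
    \<comment> \<open>The three extra points make the single radius \<open>e\<close> also bounded by
      \<open>cut i\<close>, \<open>1 - cut i\<close> and \<open>1 / n\<close>; halving it later
      gives the strict inequalities.\<close>
    have "finite (T \<union> {0, 1, cut i + 1 / n})" using T(1) by simp
    from finite_set_avoid[OF this, of "cut i"] obtain e where e: "e > 0"
      "\<And>t. t \<in> T \<union> {0, 1, cut i + 1 / n} \<Longrightarrow> t \<noteq> cut i \<Longrightarrow> e \<le> dist (cut i) t"
      by blast
    have "e \<le> dist (cut i) t" if "t \<in> T" for t
      using e(2)[of t] that T(2)[OF i] by (auto simp: cut_def)
    then have "t \<notin> {cut i - e / 2..cut i + e / 2}" if "t \<in> T" for t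
      using that e(1) by (fastforce simp: dist_real_def abs_if split: if_splits)
    moreover have "e \<le> 1 / n" "e \<le> cut i" "e \<le> 1 - cut i"
      using e(2)[of "cut i + 1 / n"] e(2)[of 0] e(2)[of 1] cut_range[OF i] n
      by (auto simp: dist_real_def)
    ultimately show ?thesis using e(1) by (intro exI[of _ "e / 2"]) auto
  qed
  then obtain d where d: "\<And>i. i < n \<Longrightarrow> 0 < d i \<and> d i < 1 / n \<and> 0 \<le> cut i - d i \<and>
      cut i + d i < 1 \<and> (\<forall>t\<in>T. t \<notin> {cut i - d i..cut i + d i})"
    by metis
  show thesis
  proof (rule that[of "\<lambda>i. tilted_length (cut i) (d i)" piece])
    show "valuation (tilted_length (cut i) (d i)) \<and> hungry (tilted_length (cut i) (d i))"
      if "i < n" for i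
      using d[OF that] by (intro conjI valuation_tilted_length hungry_tilted_length) auto
    show "measures_length_at n T (\<lambda>i. tilted_length (cut i) (d i))"
      unfolding measures_length_at_def
    proof (intro allI impI ballI)
      fix i x z A assume "i < n" "x \<in> T" "z \<in> T" "arc_from x z A"
      with d[OF \<open>i < n\<close>] show "tilted_length (cut i) (d i) A = measure lborel A"
        by (intro tilted_length_unchanged[of _ _ x z]) auto
    qed
    show "connected_allocation n piece" by (rule connected_allocation_piece)
    show "strongly_proportional n (\<lambda>i. tilted_length (cut i) (d i)) piece"
      using d tilted_piece_gt by (simp add: strongly_proportional_def)
  qed
qed

end

section \<open>Placing the cut away from the probed points, and the contradiction\<close>

lemma finite_avoiding_shift:
  fixes T :: "real set"
  assumes "finite T" "a < b"
  obtains c where "a < c" "c < b" "\<And>i. i < (n::nat) \<Longrightarrow> c + f i \<notin> T"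
proof -
  \<comment> \<open>Each \<open>i\<close> forbids only the finitely many offsets
    \<open>t - f i\<close>, while the open interval is infinite.\<close>
  have "finite (\<Union>i<n. (\<lambda>t. t - f i) ` T)" using assms(1) by simp
  moreover have "infinite {a<..<b}" using assms(2) by (rule infinite_Ioo)
  ultimately obtain c where "c \<in> {a<..<b}" and c: "c \<notin> (\<Union>i<n. (\<lambda>t. t - f i) ` T)"
    by (meson finite_subset subsetI)
  moreover from c have "c + f i \<notin> T" if "i < n" for i
    using that by (force simp: image_iff)
  ultimately show thesis using that by auto
qed

theorem theorem14:
  fixes n :: nat
  assumes "n \<ge> 2"
  shows "\<not> (\<exists>alg. decides_for_hungry n alg
            (\<lambda>V. \<exists>P. connected_allocation n P \<and> strongly_proportional n V P))"
proof
  let ?Q = "\<lambda>V. \<exists>P. connected_allocation n P \<and> strongly_proportional n V P"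
  assume "\<exists>alg. decides_for_hungry n alg ?Q"
  then obtain alg where alg: "\<And>V. (\<And>i. i < n \<Longrightarrow> valuation (V i) \<and> hungry (V i)) \<Longrightarrow>
      halts_with n V alg [] (?Q V)"
    by (auto simp: decides_for_hungry_def)
  have "valuation (measure lborel)" "hungry (measure lborel)"
    using valuation_tilted_length[of 0 0] hungry_tilted_length[of 0 0]
    by (simp_all add: tilted_length_zero)
  then have "halts_with n (\<lambda>_. measure lborel) alg [] (?Q (\<lambda>_. measure lborel))"
    by (intro alg conjI)
  moreover have "\<not> ?Q (\<lambda>_. measure lborel)"
    using no_strongly_proportional_length assms by auto
  ultimately have "halts_with n (\<lambda>_. measure lborel) alg [] False" by simp
  from finite_set_fixes_answer[OF this] obtain T where T: "finite T"
    "\<And>V b. measures_length_at n T V \<Longrightarrow> halts_with n V alg [] b \<Longrightarrow> b = False"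
    by blast
  have "0 < 1 / real n" using assms by simp
  \<comment> \<open>The offset is chosen after the run has fixed \<open>T\<close>; with
    \<open>f i = i / n\<close> all \<open>n\<close> cuts miss \<open>T\<close> at once.\<close>
  from finite_avoiding_shift[OF T(1) this, of n "\<lambda>i. i / n"] obtain c where
    c: "0 < c" "c < 1 / n" "\<And>i. i < n \<Longrightarrow> c + i / n \<notin> T"
    by blast
  from tilted_instance[OF assms c(1,2) T(1) c(3)] obtain V P where
    V: "\<And>i. i < n \<Longrightarrow> valuation (V i) \<and> hungry (V i)" "measures_length_at n T V"
    and "connected_allocation n P" "strongly_proportional n V P"
    by metis
  then have "?Q V" by blast
  with T(2)[OF V(2) alg[OF V(1)]] show False by blast
qed

end
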